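(* Let $G$ be an infinite group. Every nonempty strongly irreducible $G$-subshift is markable. Furthermore, if $G$ is finitely generated and endowed with a word metric, then every nonempty strongly irreducible $G$-subshift $X$ admits a $(B(r),B(37r))$-marker for all large enough integers $r$.
   Context: Let $A$ be a finite alphabet and $G$ a group. $A^G$ carries the prodiscrete topology and the left shift action $(gx)(h)=x(g^{-1}h)$. A $G$-subshift is a closed, shift-invariant subset $X\subset A^G$. For finite $F\subset G$, $L_F(X)=\{x|_F : x\in X\}$. $X$ is strongly irreducible if there is a finite $K\subset G$ such that whenever $S,T\subset G$ are finite with $SK\cap T=\varnothing$, for every $p\in L_S(X)$ and $q\in L_T(X)$ there is $x\in X$ with $x|_S=p$ and $x|_T=q$. $\operatorname{Fix}(X)=\{g\in G: gx=x\text{ for all }x\in X\}$. For a pattern $p\in A^F$ ($F\subset G$ finite) and $g\in G$, $gp\in A^{gF}$ is given by $gp(t)=p(g^{-1}t)$; $p$ is $g$-overlapping if $p(h)=gp(h)$ for every $h\in F\cap gF$, and non-$g$-overlapping otherwise. For finite $Y\subsetneq W\subset G$, a $(Y,W)$-marker for $X$ is a pattern $p\in L_{W\smallsetminus Y}(X)$ that is non-$g$-overlapping for all $g\in WY^{-1}\smallsetminus\operatorname{Fix}(X)$. $X$ is markable if for every finite $Y\subset G$ there exist a finite $W\subset G$ and a $(Y,W)$-marker for $X$. A word metric on $G$ is the one given by a finite symmetric generating set, and $B(r)$ is the ball of radius $r$ centered at the identity. *)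

theory Defs
  imports "HOL-Analysis.Function_Topology"
begin

text \<open>
  The group \<open>G\<close> is an arbitrary type of class \<^class>\<open>group_add\<close>, which does not assume
  commutativity. Since this class is written additively, \<open>g + h\<close> stands for the product
  \<open>gh\<close>, \<open>- g\<close> for the inverse of \<open>g\<close>, \<open>g - h\<close> for \<open>g h\<^sup>-\<^sup>1\<close>, and \<open>0\<close> for the identity.
  Products of sets are written out elementwise, since \<open>-\<close> on sets is complement or difference.

  A pattern with support \<open>F\<close> is a function that is undefined outside \<open>F\<close>
  (as in \<^const>\<open>extensional\<close>); its support is passed explicitly where it is needed.
\<close>

definition translate :: "'g::group_add \<Rightarrow> ('g \<Rightarrow> 'a) \<Rightarrow> 'g \<Rightarrow> 'a" where
  "translate g x = (\<lambda>h. x (- g + h))"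

definition subshift :: "'a set \<Rightarrow> ('g::group_add \<Rightarrow> 'a) set \<Rightarrow> bool" where
  "subshift A X \<longleftrightarrow>
     closedin (product_topology (\<lambda>_. discrete_topology A) UNIV) X \<and>
     (\<forall>g. \<forall>x\<in>X. translate g x \<in> X)"

definition language :: "'g set \<Rightarrow> ('g \<Rightarrow> 'a) set \<Rightarrow> ('g \<Rightarrow> 'a) set" where
  "language F X = (\<lambda>x. restrict x F) ` X"

definition strongly_irreducible :: "('g::group_add \<Rightarrow> 'a) set \<Rightarrow> bool" where
  "strongly_irreducible X \<longleftrightarrow>
     (\<exists>K. finite K \<and>
       (\<forall>S T. finite S \<and> finite T \<and> {s + k |s k. s \<in> S \<and> k \<in> K} \<inter> T = {} \<longrightarrow>
         (\<forall>p\<in>language S X. \<forall>q\<in>language T X.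
            \<exists>x\<in>X. restrict x S = p \<and> restrict x T = q)))"

definition Fix :: "('g::group_add \<Rightarrow> 'a) set \<Rightarrow> 'g set" where
  "Fix X = {g. \<forall>x\<in>X. translate g x = x}"

text \<open>
  If \<open>p\<close> has support \<open>F\<close>, then \<open>translate g p\<close> is the pattern \<open>gp\<close>, with support \<open>gF\<close>.
\<close>

definition overlapping :: "'g::group_add \<Rightarrow> 'g set \<Rightarrow> ('g \<Rightarrow> 'a) \<Rightarrow> bool" where
  "overlapping g F p \<longleftrightarrow> (\<forall>h \<in> F \<inter> (\<lambda>f. g + f) ` F. p h = translate g p h)"

definition marker :: "'g::group_add set \<Rightarrow> 'g set \<Rightarrow> ('g \<Rightarrow> 'a) set \<Rightarrow> ('g \<Rightarrow> 'a) \<Rightarrow> bool" where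
  "marker Y W X p \<longleftrightarrow>
     finite Y \<and> finite W \<and> Y \<subset> W \<and>
     p \<in> language (W - Y) X \<and>
     (\<forall>g \<in> {w - y |w y. w \<in> W \<and> y \<in> Y} - Fix X. \<not> overlapping g (W - Y) p)"

definition markable :: "('g::group_add \<Rightarrow> 'a) set \<Rightarrow> bool" where
  "markable X \<longleftrightarrow> (\<forall>Y. finite Y \<longrightarrow> (\<exists>W p. finite W \<and> marker Y W X p))"

text \<open>
  As \<open>S\<close> is closed under inverses, the subgroup generated by \<open>S\<close> consists of the products of
  words over \<open>S\<close>.
\<close>

definition finite_symmetric_generating_set :: "'g::group_add set \<Rightarrow> bool" where
  "finite_symmetric_generating_set S \<longleftrightarrow>
     finite S \<and> (\<forall>s\<in>S. - s \<in> S) \<and> (\<forall>g. \<exists>ws. set ws \<subseteq> S \<and> sum_list ws = g)"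

definition word_metric :: "'g::group_add set \<Rightarrow> 'g \<Rightarrow> 'g \<Rightarrow> nat" where
  "word_metric S g h = (LEAST n. \<exists>ws. set ws \<subseteq> S \<and> length ws = n \<and> g + sum_list ws = h)"

definition word_ball :: "'g::group_add set \<Rightarrow> nat \<Rightarrow> 'g set" where
  "word_ball S r = {g. word_metric S 0 g \<le> r}"

end

theory Submission
  imports Defs "HOL-Real_Asymp.Real_Asymp"
begin

text \<open>
  The marker is found by counting. Put \<open>F = W - Y\<close>. For \<open>g \<notin> Fix X\<close>, the positions \<open>h\<close> at which
  some \<open>x \<in> X\<close> satisfies \<open>x(h) \<noteq> x(g\<^sup>-\<^sup>1h)\<close> are syndetic, uniformly in \<open>g\<close>. At such a position, strong
  irreducibility allows breaking the equality \<open>p(h) = p(g\<^sup>-\<^sup>1h)\<close> by changing \<open>p \<in> L\<^sub>F(X)\<close> only in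
  \<open>{h, g\<^sup>-\<^sup>1h}K\<close>, so imposing the equality at one more such position, well separated from the
  previous ones, multiplies the number of patterns by a factor bounded away from 1. Let \<open>B\<^sub>n\<close> be
  the set of products of at most \<open>n\<close> elements of a symmetric set, let \<open>Y \<subseteq> B\<^sub>r\<close> and \<open>W = B\<^bsub>37r\<^esub>\<close>.
  Every \<open>g \<in> WY\<^sup>-\<^sup>1\<close> is a product \<open>uv\<close> with \<open>u, v \<in> B\<^bsub>19r\<^esub>\<close>, and \<open>uB\<^bsub>13r\<^esub>\<close> lies in \<open>W \<inter> gW\<close>. Hence the
  proportion of \<open>g\<close>-overlapping patterns is exponentially small in \<open>|B\<^sub>r|\<close>, while there are only
  \<open>|B\<^bsub>38r\<^esub>| \<le> |B\<^sub>r|\<^bsup>38\<^esup>\<close> elements \<open>g\<close> to consider.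
\<close>

text \<open>\<open>K\<close> is a parameter because one gap set has to serve several lemmas and its
  cardinality enters the counting constants.\<close>

definition irreducible_gap :: "'g set \<Rightarrow> ('g::group_add \<Rightarrow> 'a) set \<Rightarrow> bool" where
  "irreducible_gap K X \<longleftrightarrow>
     (\<forall>S T. finite S \<and> finite T \<and> {s + k |s k. s \<in> S \<and> k \<in> K} \<inter> T = {} \<longrightarrow>
       (\<forall>p\<in>language S X. \<forall>q\<in>language T X.
          \<exists>x\<in>X. restrict x S = p \<and> restrict x T = q))"

lemma irreducible_gapD:
  assumes "irreducible_gap K X" "finite S" "finite T"
    and "\<And>s k. s \<in> S \<Longrightarrow> k \<in> K \<Longrightarrow> s + k \<notin> T" and "y \<in> X" "z \<in> X"
  obtains x where "x \<in> X" "\<And>s. s \<in> S \<Longrightarrow> x s = y s" "\<And>t. t \<in> T \<Longrightarrow> x t = z t"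
proof -
  have "{s + k |s k. s \<in> S \<and> k \<in> K} \<inter> T = {}"
    using assms(4) by blast
  moreover have "restrict y S \<in> language S X" "restrict z T \<in> language T X"
    using assms(5,6) by (auto simp: language_def)
  ultimately obtain x where x: "x \<in> X" "restrict x S = restrict y S" "restrict x T = restrict z T"
    using assms(1-3) unfolding irreducible_gap_def by meson
  show thesis
    using that[OF x(1)] x(2,3) by (metis restrict_apply')
qed

lemma translate_add: "translate g (translate h x) = translate (g + h) x"
  by (simp add: translate_def add.assoc minus_add del: add_uminus_conv_diff)

section \<open>Positions that detect a translation\<close>

text \<open>If \<open>k\<close> is outside \<open>K\<close>, the values at \<open>0\<close> and
  \<open>k\<close> can be prescribed independently. Unless \<open>Fix X\<close> is everything, some
  point of \<open>X\<close> takes two values, and its translates put them at \<open>0\<close> and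
  \<open>k\<close>; so every such \<open>k\<close> lies in \<open>K\<close>.\<close>

lemma finite_common_period:
  fixes X :: "('g::group_add \<Rightarrow> 'a) set"
  assumes inv: "\<And>g x. x \<in> X \<Longrightarrow> translate g x \<in> X"
    and K: "irreducible_gap K X" "finite K"
  shows "finite ({k. \<forall>x\<in>X. x 0 = x k} - Fix X)"
proof (cases "Fix X = UNIV")
  case False
  then obtain g x h where x: "x \<in> X" "x (- g + h) \<noteq> x h"
    by (auto simp: Fix_def translate_def fun_eq_iff)
  have "k \<in> K" if k: "\<forall>x\<in>X. x 0 = x k" for k
  proof (rule ccontr)
    assume "k \<notin> K"
    define y where "y = translate (- h) x"
    define z where "z = translate (k - h + g) x"
    have "y \<in> X" "z \<in> X"
      unfolding y_def z_def by (intro inv x(1))+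
    then obtain w where w: "w \<in> X" "\<And>s. s \<in> {0} \<Longrightarrow> w s = y s" "\<And>t. t \<in> {k} \<Longrightarrow> w t = z t"
      using irreducible_gapD[OF K(1), of "{0}" "{k}" y z] \<open>k \<notin> K\<close> by auto
    have "y 0 = x h" "z k = x (- g + h)"
      by (simp_all add: y_def z_def translate_def minus_add add.assoc diff_conv_add_uminus
          del: add_uminus_conv_diff)
    then show False
      using w k x(2) by auto
  qed
  then have "{k. \<forall>x\<in>X. x 0 = x k} - Fix X \<subseteq> K"
    by auto
  then show ?thesis
    using K(2) finite_subset by blast
qed auto

text \<open>Whether \<open>h\<close> detects \<open>g\<close> depends only on the conjugate of
  \<open>g\<close> by \<open>h\<close>. For \<open>g\<close> outside \<open>Fix X\<close> it fails
  only if this conjugate lies in the finite set \<open>N\<close>, and then one fixed position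
  \<open>c n\<close> per \<open>n\<close> in \<open>N\<close>, shifted by \<open>h\<close>, detects
  \<open>g\<close>.\<close>

lemma syndetic_detection:
  fixes X :: "('g::group_add \<Rightarrow> 'a) set"
  assumes inv: "\<And>g x. x \<in> X \<Longrightarrow> translate g x \<in> X"
    and K: "irreducible_gap K X" "finite K"
  obtains D where "finite D" "D \<noteq> {}"
    "\<And>g h. g \<notin> Fix X \<Longrightarrow> \<exists>d\<in>D. \<exists>x\<in>X. x (h + d) \<noteq> x (- g + (h + d))"
proof -
  define N where "N = {k. \<forall>x\<in>X. x 0 = x k} - Fix X"
  have "\<exists>d. \<exists>x\<in>X. x d \<noteq> x (- n + d)" if "n \<in> N" for n
    using that by (simp add: N_def Fix_def translate_def fun_eq_iff) metis
  then obtain c where c: "\<And>n. n \<in> N \<Longrightarrow> \<exists>x\<in>X. x (c n) \<noteq> x (- n + c n)"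
    by metis
  show thesis
  proof
    show "finite (insert 0 (c ` N))"
      using finite_common_period[OF assms] by (simp add: N_def)
    fix g h assume g: "g \<notin> Fix X"
    show "\<exists>d\<in>insert 0 (c ` N). \<exists>x\<in>X. x (h + d) \<noteq> x (- g + (h + d))"
    proof (rule ccontr)
      assume *: "\<not> ?thesis"
      \<comment> \<open>If \<open>h\<close> does not detect \<open>g\<close>, then this conjugate of \<open>g\<close> is one of the finitely many elements of \<open>N\<close>.\<close>
      define n where "n = - h + g + h"
      have "x 0 = x n" if "x \<in> X" for x
      proof -
        \<comment> \<open>This translate takes the value \<open>x n\<close> at \<open>h\<close> and
          \<open>x 0\<close> at \<open>- g + h\<close>.\<close>
        have "translate (h - n) x \<in> X"
          using that by (rule inv)
        then have "translate (h - n) x h = translate (h - n) x (- g + h)"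
          using * by simp
        then show ?thesis
          by (simp add: translate_def n_def minus_add add.assoc diff_conv_add_uminus
              del: add_uminus_conv_diff)
      qed
      moreover have "n \<notin> Fix X"
      proof
        assume n: "n \<in> Fix X"
        have "translate g x = x" if "x \<in> X" for x
        proof -
          have "translate n (translate (- h) x) = translate (- h) x"
            using n inv[OF that] by (simp add: Fix_def)
          then have "translate h (translate n (translate (- h) x)) = translate h (translate (- h) x)"
            by simp
          then show ?thesis
            by (simp add: translate_add n_def add.assoc del: add_uminus_conv_diff)
              (simp add: translate_def)
        qed
        then show False
          using g by (simp add: Fix_def)
      qed
      ultimately have "n \<in> N"
        by (simp add: N_def)
      then obtain x where x: "x \<in> X" "x (c n) \<noteq> x (- n + c n)"
        using c by blast
      have "translate h x (h + c n) = translate h x (- g + (h + c n))"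
        using * inv[OF x(1)] \<open>n \<in> N\<close> by blast
      then show False
        using x(2) by (simp add: translate_def n_def minus_add add.assoc del: add_uminus_conv_diff)
    qed
  qed auto
qed

section \<open>Counting overlapping patterns\<close>

text \<open>If every \<open>e\<close> in \<open>E\<close> has both \<open>e\<close> and
  \<open>- g + e\<close> in \<open>F\<close>, all \<open>g\<close>-overlapping patterns of
  \<open>language F X\<close> belong to this set. A variable \<open>E\<close> lets the equalities be
  imposed one at a time.\<close>

definition periodic_patterns :: "'g set \<Rightarrow> ('g::group_add \<Rightarrow> 'a) set \<Rightarrow> 'g \<Rightarrow> 'g set \<Rightarrow> ('g \<Rightarrow> 'a) set"
  where "periodic_patterns F X g E = {p \<in> language F X. \<forall>h\<in>E. p h = p (- g + h)}"

lemma card_le_fibre_bound: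
  assumes "finite Q" "f ` P \<subseteq> Q" "finite P" "\<And>q. q \<in> Q \<Longrightarrow> card {p \<in> P. f p = q} \<le> c"
  shows "card P \<le> c * card Q"
proof -
  have "P = (\<Union>q\<in>Q. {p \<in> P. f p = q})"
    using assms(2) by auto
  then have "card P \<le> (\<Sum>q\<in>Q. card {p \<in> P. f p = q})"
    using card_UN_le[OF assms(1)] by metis
  also have "\<dots> \<le> (\<Sum>q\<in>Q. c)"
    by (rule sum_mono) (rule assms(4))
  finally show ?thesis
    by (simp add: mult.commute)
qed

lemma language_subset_PiE:
  assumes "X \<subseteq> UNIV \<rightarrow>\<^sub>E A"
  shows "language F X \<subseteq> F \<rightarrow>\<^sub>E A"
  using assms by (auto simp: language_def PiE_def Pi_def subset_iff)

text \<open>Forcing the values of \<open>x\<close> at \<open>h\<close> and \<open>- g + h\<close>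
  turns a pattern obeying all equalities into one that breaks the equality at \<open>h\<close> and
  keeps those on \<open>E\<close>. Only positions in \<open>Z\<close> change, so this map from
  \<open>P\<close> to \<open>R - P\<close> is at most \<open>C\<close>-to-one.\<close>

lemma card_periodic_patterns_insert:
  fixes X :: "('g::group_add \<Rightarrow> 'a) set"
  assumes A: "finite A" "X \<subseteq> UNIV \<rightarrow>\<^sub>E A" "X \<noteq> {}"
    and K: "irreducible_gap K X" "finite K"
    and F: "finite F" "h \<in> F" "- g + h \<in> F"
    and x: "x \<in> X" "x h \<noteq> x (- g + h)"
    and E: "\<And>e. e \<in> E \<Longrightarrow> e \<in> F \<and> - g + e \<in> F"
      "\<And>e s k. e \<in> E \<Longrightarrow> s \<in> {h, - g + h} \<Longrightarrow> k \<in> K \<Longrightarrow> e \<noteq> s + k \<and> - g + e \<noteq> s + k"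
  defines "C \<equiv> card A ^ (2 * card K)"
  shows "card (periodic_patterns F X g (insert h E)) * (C + 1) \<le> C * card (periodic_patterns F X g E)"
proof -
  define P where "P = periodic_patterns F X g (insert h E)"
  define R where "R = periodic_patterns F X g E"
  define Z where "Z = (\<lambda>(s, k). s + k) ` ({h, - g + h} \<times> K)"
  have finZ: "finite Z"
    using K(2) by (simp add: Z_def)
  have cardZ: "card Z \<le> 2 * card K"
  proof -
    have "card Z \<le> card ({h, - g + h} \<times> K)"
      unfolding Z_def using K(2) by (intro card_image_le) auto
    also have "\<dots> = card {h, - g + h} * card K"
      by (rule card_cartesian_product)
    also have "\<dots> \<le> 2 * card K"
      by (intro mult_right_mono) (auto simp: card_insert_if)
    finally show ?thesis .
  qed
  have "finite (language F X)"
    using language_subset_PiE[OF A(2), of F] A(1) F(1) by (meson finite_PiE finite_subset)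
  then have finR: "finite R"
    by (simp add: R_def periodic_patterns_def)
  have PR: "P \<subseteq> R"
    by (auto simp: P_def R_def periodic_patterns_def)
  have "\<exists>p'\<in>R - P. \<forall>t\<in>F - Z. p' t = p t" if p: "p \<in> P" for p
  proof -
    obtain y where y: "y \<in> X" "p = restrict y F"
      using p by (auto simp: P_def periodic_patterns_def language_def)
    obtain z where z: "z \<in> X" "\<And>s. s \<in> {h, - g + h} \<Longrightarrow> z s = x s" "\<And>t. t \<in> F - Z \<Longrightarrow> z t = y t"
      using irreducible_gapD[OF K(1), of "{h, - g + h}" "F - Z" x y] F(1) x(1) y(1)
      by (auto simp: Z_def)
    have "restrict z F \<in> language F X"
      using z(1) by (simp add: language_def)
    moreover have "z e = z (- g + e)" if "e \<in> E" for e
    proof -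
      have "e \<in> F - Z" "- g + e \<in> F - Z"
        using E that by (auto simp: Z_def)
      moreover have "y e = y (- g + e)"
        using p that E(1)[OF that] by (auto simp: P_def periodic_patterns_def y(2))
      ultimately show ?thesis
        using z(3) by simp
    qed
    moreover have "z h \<noteq> z (- g + h)"
      using z(2) x(2) by simp
    ultimately have "restrict z F \<in> R - P"
      using E(1) F by (auto simp: R_def P_def periodic_patterns_def)
    moreover have "\<forall>t\<in>F - Z. restrict z F t = p t"
      using z(3) by (simp add: y(2))
    ultimately show ?thesis
      by blast
  qed
  then obtain f where f: "\<And>p. p \<in> P \<Longrightarrow> f p \<in> R - P" "\<And>p t. p \<in> P \<Longrightarrow> t \<in> F - Z \<Longrightarrow> f p t = p t"
    by metis
  have 1: "card P \<le> C * card (R - P)"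
  proof (rule card_le_fibre_bound)
    fix q
    let ?fib = "{p \<in> P. f p = q}"
    have Psub: "P \<subseteq> F \<rightarrow>\<^sub>E A"
      using language_subset_PiE[OF A(2)] by (auto simp: P_def periodic_patterns_def)
    \<comment> \<open>Outside \<open>Z\<close> the image \<open>q\<close> already determines the
      pattern.\<close>
    have "inj_on (\<lambda>p. restrict p (F \<inter> Z)) ?fib"
    proof (rule inj_onI)
      fix p p' assume *: "p \<in> ?fib" "p' \<in> ?fib" "restrict p (F \<inter> Z) = restrict p' (F \<inter> Z)"
      have "p \<in> extensional F" "p' \<in> extensional F"
        using * Psub by (auto simp: PiE_def)
      moreover have "p t = p' t" if "t \<in> F" for t
      proof (cases "t \<in> Z")
        case True
        then show ?thesis
          using *(3) that by (metis IntI restrict_apply')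
      next
        case False
        then show ?thesis
          using f(2)[of p t] f(2)[of p' t] * that by auto
      qed
      ultimately show "p = p'"
        by (rule extensionalityI)
    qed
    moreover have "(\<lambda>p. restrict p (F \<inter> Z)) ` ?fib \<subseteq> (F \<inter> Z) \<rightarrow>\<^sub>E A"
      using Psub by (auto simp: PiE_def Pi_def)
    ultimately have "card ?fib \<le> card ((F \<inter> Z) \<rightarrow>\<^sub>E A)"
      using F(1) A(1) by (intro card_inj_on_le) (auto intro: finite_PiE)
    also have "\<dots> = card A ^ card (F \<inter> Z)"
      using F(1) by (simp add: card_PiE)
    also have "\<dots> \<le> card A ^ (2 * card K)"
    proof (rule power_increasing)
      show "card (F \<inter> Z) \<le> 2 * card K"
        using card_mono[OF finZ, of "F \<inter> Z"] cardZ by simp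
      have "A \<noteq> {}"
        using A(2,3) by (auto simp: PiE_def Pi_def)
      then show "1 \<le> card A"
        using A(1) by (simp add: Suc_le_eq card_gt_0_iff)
    qed
    finally show "card ?fib \<le> C"
      by (simp add: C_def)
  qed (use f finR finite_subset[OF PR] in auto)
  have "card R = card (R - P) + card P"
    using PR finR by (simp add: card_Diff_subset card_mono finite_subset)
  then have "card P * (C + 1) \<le> C * card R"
    using 1 by (simp add: algebra_simps)
  then show ?thesis
    unfolding P_def R_def .
qed

text \<open>Greedy separation: each round spends one position of \<open>E\<close>, discards those
  that could interfere with it, at most \<open>4 * card K + 1\<close> in all, and gains a factor
  \<open>C / (C + 1)\<close>.\<close>

lemma card_periodic_patterns_decay:
  fixes X :: "('g::group_add \<Rightarrow> 'a) set"
  assumes A: "finite A" "X \<subseteq> UNIV \<rightarrow>\<^sub>E A" "X \<noteq> {}"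
    and K: "irreducible_gap K X" "finite K"
    and F: "finite F"
    and E: "\<And>e. e \<in> E \<Longrightarrow> e \<in> F \<and> - g + e \<in> F \<and> (\<exists>x\<in>X. x e \<noteq> x (- g + e))"
    and n: "n * (4 * card K + 1) \<le> card E"
  defines "C \<equiv> card A ^ (2 * card K)"
  shows "card (periodic_patterns F X g E) * (C + 1) ^ n \<le> C ^ n * card (language F X)"
  using E n
proof (induction n arbitrary: E)
  case 0
  have "finite (language F X)"
    using language_subset_PiE[OF A(2), of F] A(1) F by (meson finite_PiE finite_subset)
  then show ?case
    by (auto simp: periodic_patterns_def intro!: card_mono)
next
  case (Suc n)
  have finE: "finite E"
    using Suc.prems(1) F by (auto intro: finite_subset)
  have "E \<noteq> {}"
    using Suc.prems(2) by auto
  then obtain h where h: "h \<in> E"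
    by blast
  \<comment> \<open>A change made for \<open>h\<close> may touch \<open>e\<close> or
    \<open>- g + e\<close>. Solved for \<open>e\<close>, the first case gives \<open>h\<close> and
    \<open>- g + h\<close> times \<open>K\<close>, the second \<open>g + h\<close> and
    \<open>h\<close> times \<open>K\<close>.\<close>
  define Z where "Z = insert h ((\<lambda>(t, k). t + k) ` ({h, - g + h, g + h, h} \<times> K))"
  have finZ: "finite Z"
    using K(2) by (simp add: Z_def)
  have cardZ: "card Z \<le> 4 * card K + 1"
  proof -
    have "card Z \<le> Suc (card ((\<lambda>(t, k). t + k) ` ({h, - g + h, g + h, h} \<times> K)))"
      unfolding Z_def by (rule card_insert_le_m1[of "Suc _", simplified]) simp_all
    also have "card ((\<lambda>(t, k). t + k) ` ({h, - g + h, g + h, h} \<times> K)) \<le> card ({h, - g + h, g + h, h} \<times> K)"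
      using K(2) by (intro card_image_le) auto
    also have "\<dots> = card {h, - g + h, g + h, h} * card K"
      by (rule card_cartesian_product)
    also have "\<dots> \<le> 4 * card K"
      by (intro mult_right_mono) (auto simp: card_insert_if)
    finally show ?thesis by simp
  qed
  define E' where "E' = E - Z"
  have "card E - card Z \<le> card E'"
    unfolding E'_def by (rule diff_card_le_card_Diff[OF finZ])
  then have "n * (4 * card K + 1) \<le> card E'"
    using Suc.prems(2) cardZ by simp
  then have IH: "card (periodic_patterns F X g E') * (C + 1) ^ n \<le> C ^ n * card (language F X)"
    using Suc.prems(1) by (intro Suc.IH) (auto simp: E'_def)
  have "finite (periodic_patterns F X g (insert h E'))"
    using language_subset_PiE[OF A(2), of F] A(1) F
    by (auto simp: periodic_patterns_def intro: finite_subset finite_PiE)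
  then have le: "card (periodic_patterns F X g E) \<le> card (periodic_patterns F X g (insert h E'))"
    using h by (intro card_mono) (auto simp: periodic_patterns_def E'_def)
  obtain x where x: "x \<in> X" "x h \<noteq> x (- g + h)"
    using Suc.prems(1) h by blast
  have step: "card (periodic_patterns F X g (insert h E')) * (C + 1) \<le> C * card (periodic_patterns F X g E')"
    unfolding C_def
  proof (rule card_periodic_patterns_insert[OF A K F _ _ x])
    fix e s k assume *: "e \<in> E'" "s \<in> {h, - g + h}" "k \<in> K"
    have "e \<noteq> t + k" if "t \<in> {h, - g + h, g + h}" for t
      using * that by (auto simp: E'_def Z_def)
    moreover have "g + s \<in> {h, - g + h, g + h}"
      using * by (auto simp flip: add.assoc)
    ultimately have "e \<noteq> s + k" "e \<noteq> g + s + k"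
      using * by blast+
    then show "e \<noteq> s + k \<and> - g + e \<noteq> s + k"
      by (metis add.assoc add_minus_cancel)
  qed (use Suc.prems(1) h in \<open>auto simp: E'_def\<close>)
  have "card (periodic_patterns F X g E) * (C + 1) ^ Suc n
      \<le> card (periodic_patterns F X g (insert h E')) * (C + 1) * (C + 1) ^ n"
    unfolding power_Suc mult.assoc by (rule mult_right_mono[OF le]) simp
  also have "\<dots> \<le> C * card (periodic_patterns F X g E') * (C + 1) ^ n"
    by (rule mult_right_mono[OF step]) simp
  also have "\<dots> = C * (card (periodic_patterns F X g E') * (C + 1) ^ n)"
    by (rule mult.assoc)
  also have "\<dots> \<le> C * (C ^ n * card (language F X))"
    by (rule mult_left_mono[OF IH]) simp
  finally show ?case
    by (simp add: mult.assoc)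
qed

section \<open>Products of words\<close>

text \<open>\<open>S\<close> need not generate the group, so these sets replace balls in groups that
  are not finitely generated.\<close>

definition words :: "'g::group_add set \<Rightarrow> nat \<Rightarrow> 'g set" where
  "words S n = {sum_list ws |ws. set ws \<subseteq> S \<and> length ws \<le> n}"

lemma words_mono: "m \<le> n \<Longrightarrow> words S m \<subseteq> words S n"
  unfolding words_def by (blast intro: le_trans)

lemma zero_in_words: "0 \<in> words S n"
  unfolding words_def by (rule CollectI, rule exI[of _ "[]"]) simp

lemma subset_words: "1 \<le> n \<Longrightarrow> S \<subseteq> words S n"
proof
  fix s assume "1 \<le> n" "s \<in> S"
  then show "s \<in> words S n"
    unfolding words_def by (intro CollectI exI[of _ "[s]"]) simp
qed

lemma sum_list_in_words: "set ws \<subseteq> S \<Longrightarrow> length ws \<le> n \<Longrightarrow> sum_list ws \<in> words S n"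
  unfolding words_def by blast

lemma words_add:
  assumes "g \<in> words S m" "h \<in> words S n"
  shows "g + h \<in> words S (m + n)"
proof -
  obtain us vs where "set us \<subseteq> S" "length us \<le> m" "g = sum_list us"
    and "set vs \<subseteq> S" "length vs \<le> n" "h = sum_list vs"
    using assms by (auto simp: words_def)
  then show ?thesis
    using sum_list_in_words[of "us @ vs" S "m + n"] by simp
qed

lemma words_split:
  assumes "g \<in> words S (m + n)"
  obtains u v where "u \<in> words S m" "v \<in> words S n" "g = u + v"
proof -
  obtain ws where ws: "set ws \<subseteq> S" "length ws \<le> m + n" "g = sum_list ws"
    using assms by (auto simp: words_def)
  show thesis
  proof
    show "sum_list (take m ws) \<in> words S m"
      using ws(1) set_take_subset[of m ws] by (intro sum_list_in_words) auto
    show "sum_list (drop m ws) \<in> words S n"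
      using ws(1,2) set_drop_subset[of m ws] by (intro sum_list_in_words) auto
    show "g = sum_list (take m ws) + sum_list (drop m ws)"
      by (simp add: ws(3) flip: sum_list_append)
  qed
qed

lemma words_uminus:
  assumes "\<And>s. s \<in> S \<Longrightarrow> - s \<in> S" "g \<in> words S n"
  shows "- g \<in> words S n"
proof -
  obtain ws where ws: "set ws \<subseteq> S" "length ws \<le> n" "g = sum_list ws"
    using assms(2) by (auto simp: words_def)
  have "- sum_list ws = sum_list (rev (map uminus ws))" for ws :: "'a list"
    by (induction ws) (simp_all add: minus_add)
  then show ?thesis
    using ws assms(1) unfolding words_def
    by (intro CollectI exI[of _ "rev (map uminus ws)"]) auto
qed

lemma finite_words: "finite S \<Longrightarrow> finite (words S n)"
proof -
  assume "finite S"
  then have "finite (sum_list ` {ws. set ws \<subseteq> S \<and> length ws \<le> n})"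
    by (intro finite_imageI finite_lists_length_le)
  then show ?thesis
    by (rule rev_finite_subset) (auto simp: words_def)
qed

section \<open>Growth of the word sets\<close>

text \<open>Words are cut into \<open>k\<close> blocks of length at most \<open>r\<close>. The bound
  is polynomial in \<open>card (words S r)\<close>, hence beaten by exponential decay.\<close>

lemma card_words_mult:
  assumes "finite S"
  shows "card (words S (k * r)) \<le> card (words S r) ^ k"
proof (induction k)
  case 0
  then show ?case by (simp add: words_def)
next
  case (Suc k)
  have "words S (Suc k * r) \<subseteq> (\<lambda>(u, v). u + v) ` (words S r \<times> words S (k * r))"
    by (auto elim!: words_split)
  then have "card (words S (Suc k * r)) \<le> card (words S r \<times> words S (k * r))"
    using assms by (intro surj_card_le) (auto intro: finite_words)
  also have "\<dots> \<le> card (words S r) * card (words S r) ^ k"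
    using Suc by (simp add: card_cartesian_product)
  finally show ?case by simp
qed

text \<open>If two consecutive sets agree, the sequence is constant from there on, and a finite set
  would exhaust the group.\<close>

lemma words_strict:
  fixes S :: "'g::group_add set"
  assumes inf: "infinite (UNIV :: 'g set)" and S: "finite S" "\<And>g. \<exists>n. g \<in> words S n"
  shows "words S n \<subset> words S (Suc n)"
proof -
  have "words S (Suc n) \<noteq> words S n"
  proof
    assume eq: "words S (Suc n) = words S n"
    have "words S (n + k) \<subseteq> words S n" for k
    proof (induction k)
      case (Suc k)
      show ?case
      proof
        fix g assume "g \<in> words S (n + Suc k)"
        then have "g \<in> words S ((n + k) + 1)" by simp
        then obtain u v where "u \<in> words S (n + k)" "v \<in> words S 1" "g = u + v"
          by (rule words_split)
        then show "g \<in> words S n"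
          using Suc words_add[of u S n v 1] eq by auto
      qed
    qed simp
    then have "g \<in> words S n" for g
      using S(2)[of g] by (metis le_add2 subsetD words_mono)
    then have "UNIV = words S n" by blast
    then show False
      using inf finite_words[OF S(1), of n] by simp
  qed
  then show ?thesis
    using words_mono[of n "Suc n" S] by auto
qed

lemma less_card_words:
  fixes S :: "'g::group_add set"
  assumes "infinite (UNIV :: 'g set)" and "finite S" "\<And>g. \<exists>n. g \<in> words S n"
  shows "n < card (words S n)"
proof (induction n)
  case 0
  then show ?case by (simp add: words_def)
next
  case (Suc n)
  have "card (words S n) < card (words S (Suc n))"
    using words_strict[OF assms] finite_words[OF assms(2)] by (intro psubset_card_mono)
  with Suc show ?case by simp
qed

text \<open>For \<open>Y = words S r\<close>, each of the two holes to be avoided has at most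
  \<open>card (words S (2 * r))\<close> elements; a factor 3 leaves enough room, as
  \<open>1 + 4 \<le> 2 * 3\<close>.\<close>

lemma three_balls:
  fixes S :: "'g::group_add set"
  assumes inf: "infinite (UNIV :: 'g set)" and S: "finite S" "\<And>g. \<exists>n. g \<in> words S n"
    and sym: "\<And>s. s \<in> S \<Longrightarrow> - s \<in> S" and r: "1 \<le> r"
  shows "3 * card (words S (2 * r)) \<le> card (words S (12 * r))"
proof -
  \<comment> \<open>The centres \<open>0\<close>, \<open>z\<close>, \<open>z'\<close> are at distance more than \<open>4r\<close> from each other, so the balls of radius \<open>2r\<close> around them are disjoint.\<close>
  obtain z where z: "z \<in> words S (Suc (4 * r))" "z \<notin> words S (4 * r)"
    using words_strict[OF inf S] by blast
  obtain z' where z': "z' \<in> words S (Suc (9 * r))" "z' \<notin> words S (9 * r)"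
    using words_strict[OF inf S] by blast
  let ?B = "words S (2 * r)"
  let ?T = "\<lambda>z. (+) z ` ?B"
  have card: "card (?T z) = card ?B" for z
    by (intro card_image) auto
  have fin: "finite (?T z)" for z
    using S(1) by (simp add: finite_words)
  have diff: "v \<in> words S (n + 4 * r)" if "u + a = v + b" "a \<in> ?B" "b \<in> ?B" "u \<in> words S n" for u v a b n
  proof -
    have "- b \<in> ?B"
      by (rule words_uminus) (fact sym that)+
    with that(2) have "a + - b \<in> words S (2 * r + 2 * r)"
      by (rule words_add)
    then have "u + (a + - b) \<in> words S (n + (2 * r + 2 * r))"
      using that(4) by (rule words_add[rotated])
    moreover have "v = u + (a + - b)"
      using that(1) by (metis add.assoc add.right_neutral add.right_inverse)
    ultimately show ?thesis by simp
  qed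
  have d1: "?T 0 \<inter> ?T z = {}"
    using diff[of 0 _ z _ 0] z(2) zero_in_words[of S 0] by fastforce
  \<comment> \<open>From \<open>1 \<le> r\<close>, the length \<open>4 * r + 1\<close> of
    \<open>z\<close> plus \<open>4 * r\<close> is at most \<open>9 * r\<close>; likewise the ball
    around \<open>z'\<close> reaches only \<open>11 * r + 1 \<le> 12 * r\<close>.\<close>
  have "words S (0 + 4 * r) \<subseteq> words S (9 * r)" "words S (Suc (4 * r) + 4 * r) \<subseteq> words S (9 * r)"
    using r by (intro words_mono; simp)+
  then have d2: "?T 0 \<inter> ?T z' = {}" "?T z \<inter> ?T z' = {}"
    using diff[of 0 _ z' _ 0] diff[of z _ z' _ "Suc (4 * r)"] z z'(2) zero_in_words[of S 0] by fastforce+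
  have "card (?T 0 \<union> ?T z \<union> ?T z') = card (?T 0) + card (?T z) + card (?T z')"
    using d1 d2 fin finite_words[OF S(1)]
    by (simp add: card_Un_disjoint Int_Un_distrib2 del: image_add_0)
  then have "3 * card ?B = card (?T 0 \<union> ?T z \<union> ?T z')"
    by (simp add: card del: image_add_0)
  also have "\<dots> \<le> card (words S (12 * r))"
  proof (rule card_mono[OF finite_words[OF S(1)]])
    have "?T u \<subseteq> words S (12 * r)" if "u \<in> words S n" "n + 2 * r \<le> 12 * r" for u n
      using words_add[OF that(1)] words_mono[OF that(2), of S] by blast
    from this[OF zero_in_words[of S 0]] this[OF z(1)] this[OF z'(1)]
    show "?T 0 \<union> ?T z \<union> ?T z' \<subseteq> words S (12 * r)"
      using r by simp
  qed
  finally show ?thesis .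
qed

text \<open>Since \<open>S\<close> generates, the \<open>LEAST\<close> in \<open>word_metric\<close>
  is attained by an actual word.\<close>

lemma word_ball_eq_words:
  assumes "finite_symmetric_generating_set S"
  shows "word_ball S r = words S r"
proof -
  have "word_metric S 0 g \<le> r \<longleftrightarrow> g \<in> words S r" for g
  proof -
    let ?P = "\<lambda>n. \<exists>ws. set ws \<subseteq> S \<and> length ws = n \<and> 0 + sum_list ws = g"
    obtain ws where "set ws \<subseteq> S" "sum_list ws = g"
      using assms unfolding finite_symmetric_generating_set_def by blast
    then have "?P (length ws)"
      by (intro exI[of _ ws]) simp
    then have "?P (word_metric S 0 g)"
      unfolding word_metric_def by (rule LeastI)
    then have "g \<in> words S (word_metric S 0 g)"
      by (auto simp: words_def)
    moreover have "word_metric S 0 g \<le> r" if g: "g \<in> words S r"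
    proof -
      obtain vs where vs: "set vs \<subseteq> S" "length vs \<le> r" "g = sum_list vs"
        using g by (auto simp: words_def)
      then have "?P (length vs)"
        by (intro exI[of _ vs]) simp
      then have "word_metric S 0 g \<le> length vs"
        unfolding word_metric_def by (rule Least_le)
      with vs(2) show ?thesis
        by simp
    qed
    ultimately show ?thesis
      using words_mono by blast
  qed
  then show ?thesis
    by (auto simp: word_ball_def)
qed

section \<open>Markers\<close>

text \<open>Common criterion for both claims. \<open>D\<close> and \<open>M\<close> depend only on
  \<open>A\<close> and \<open>X\<close>, so \<open>S\<close> may be chosen after them. The last
  inequality keeps at least half of \<open>card (words S r)\<close> positions after both holes are
  removed.\<close>

lemma marker_exists:
  fixes X :: "('g::group_add \<Rightarrow> 'a) set"
  assumes A: "finite A" "subshift A X" "X \<noteq> {}" and irr: "strongly_irreducible X"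
  obtains D M where "finite D"
    "\<And>S r Y. \<lbrakk>finite S; \<And>s. s \<in> S \<Longrightarrow> - s \<in> S; D \<subseteq> words S r; Y \<subseteq> words S r;
        Y \<subset> words S (37 * r); M \<le> card (words S r);
        card (words S r) + 4 * card {y - d |y d. y \<in> Y \<and> d \<in> D} \<le> 2 * card (words S (12 * r))\<rbrakk>
      \<Longrightarrow> \<exists>p. marker Y (words S (37 * r)) X p"
proof -
  have XA: "X \<subseteq> UNIV \<rightarrow>\<^sub>E A"
    using A(2) by (auto simp: subshift_def closedin_def)
  have inv: "translate g x \<in> X" if "x \<in> X" for g x
    using A(2) that by (simp add: subshift_def)
  obtain K where K: "finite K" "irreducible_gap K X"
    using irr by (auto simp: strongly_irreducible_def irreducible_gap_def)
  obtain D where D: "finite D" "D \<noteq> {}"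
    "\<And>g h. g \<notin> Fix X \<Longrightarrow> \<exists>d\<in>D. \<exists>x\<in>X. x (h + d) \<noteq> x (- g + (h + d))"
    using syndetic_detection[OF inv K(2,1)] by blast
  define q where "q = 4 * card K + 1"
  define C where "C = card A ^ (2 * card K)"
  \<comment> \<open>\<open>q\<close> positions buy one factor \<open>\<theta>\<close>; the loss
    \<open>2 * card D\<close> comes from halving and from passing from \<open>h\<close> to
    \<open>h + d\<close>.\<close>
  define c where "c = 2 * card D * q"
  define \<theta> where "\<theta> = real C / (real C + 1)"
  have "A \<noteq> {}"
    using XA A(3) by (auto simp: PiE_def Pi_def)
  then have "C > 0"
    using A(1) by (simp add: C_def card_gt_0_iff)
  then have \<theta>: "0 < \<theta>" "\<theta> < 1"
    by (simp_all add: \<theta>_def)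
  have c: "c > 0"
    using D(1,2) by (simp add: c_def q_def card_gt_0_iff)
  \<comment> \<open>The exponent is 38 because the relevant \<open>g\<close> lie in
    \<open>words S (38 * r)\<close>, from \<open>37 * r\<close> for \<open>W\<close> and
    \<open>r\<close> for \<open>Y\<close>.\<close>
  have "((\<lambda>n. (real c * (real n + 1)) ^ 38 * \<theta> ^ n) \<longlongrightarrow> 0) sequentially"
    using \<theta> c by real_asymp
  then have "eventually (\<lambda>n. (real c * (real n + 1)) ^ 38 * \<theta> ^ n < 1) sequentially"
    by (rule order_tendstoD) simp
  then obtain M where M: "\<And>n. n \<ge> M \<Longrightarrow> (real c * (real n + 1)) ^ 38 * \<theta> ^ n < 1"
    by (auto simp: eventually_sequentially)
  show thesis
  proof
    show "finite D" by fact
    fix S :: "'g set" and r Y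
    assume S: "finite S" and sym: "\<And>s. s \<in> S \<Longrightarrow> - s \<in> S" and Dr: "D \<subseteq> words S r"
      and Yr: "Y \<subseteq> words S r" and YW: "Y \<subset> words S (37 * r)"
      and large: "c * M \<le> card (words S r)"
      and big: "card (words S r) + 4 * card {y - d |y d. y \<in> Y \<and> d \<in> D} \<le> 2 * card (words S (12 * r))"
    define W where "W = words S (37 * r)"
    define F where "F = W - Y"
    define E where "E g = {h \<in> F. - g + h \<in> F \<and> (\<exists>x\<in>X. x h \<noteq> x (- g + h))}" for g
    \<comment> \<open>The number of factors \<open>\<theta>\<close> available; the rounding is
      absorbed by \<open>n + 1\<close> in the bound on \<open>card \<Gamma>\<close>.\<close>
    define n where "n = card (words S r) div c"
    define \<Gamma> where "\<Gamma> = {w - y |w y. w \<in> W \<and> y \<in> Y} - Fix X"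
    have finW: "finite W" and finY: "finite Y" and finF: "finite F"
      using S Yr by (auto simp: W_def F_def intro: finite_words finite_subset)
    have finL: "finite (language F X)"
      using language_subset_PiE[OF XA, of F] A(1) finF by (meson finite_PiE finite_subset)
    have Lpos: "card (language F X) > 0"
      using finL A(3) by (auto simp: card_gt_0_iff language_def)
    have \<Gamma>sub: "\<Gamma> \<subseteq> words S (38 * r)"
    proof
      fix g assume "g \<in> \<Gamma>"
      then obtain w y where "g = w + - y" "w \<in> words S (37 * r)" "y \<in> words S r"
        using Yr by (auto simp: \<Gamma>_def W_def)
      then have "g \<in> words S (37 * r + r)"
        using words_add words_uminus[OF sym] by blast
      then show "g \<in> words S (38 * r)"
        by (simp add: algebra_simps)
    qed
    then have fin\<Gamma>: "finite \<Gamma>"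
      using finite_words[OF S] finite_subset by blast
    have "card \<Gamma> \<le> card (words S r) ^ 38"
      using card_mono[OF finite_words[OF S] \<Gamma>sub] card_words_mult[OF S, of 38 r] by simp
    moreover have "card (words S r) \<le> c * (n + 1)"
      unfolding n_def using c dividend_less_div_times[of c "card (words S r)"]
      by (simp add: algebra_simps)
    ultimately have "card \<Gamma> \<le> (c * (n + 1)) ^ 38"
      by (meson order.trans power_mono zero_le)
    then have "real (card \<Gamma>) \<le> real ((c * (n + 1)) ^ 38)"
      by (simp only: of_nat_le_iff)
    then have card\<Gamma>: "real (card \<Gamma>) \<le> (real c * (real n + 1)) ^ 38"
      by (simp only: of_nat_power of_nat_mult of_nat_add of_nat_1)
    have nM: "M \<le> n"
      using large c by (simp add: n_def less_eq_div_iff_mult_less_eq mult.commute)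
    have cardE: "n * q \<le> card (E g)" if "g \<in> \<Gamma>" for g
    proof -
      \<comment> \<open>Halving \<open>g\<close> balances the two positions: for
        \<open>h = u + t\<close>, the partner \<open>- g + h\<close> is \<open>- v + t\<close>, so
        after adding \<open>d\<close> both have length at most
        \<open>19 * r + 13 * r\<close>.\<close>
      have "g \<in> words S (19 * r + 19 * r)"
        using that \<Gamma>sub by auto
      then obtain u v where uv: "u \<in> words S (19 * r)" "v \<in> words S (19 * r)" "g = u + v"
        by (rule words_split)
      define Q where "Q = {y - d |y d. y \<in> Y \<and> d \<in> D}"
      have "Q = (\<lambda>(y, d). y - d) ` (Y \<times> D)"
        by (auto simp: Q_def)
      then have finQ: "finite Q"
        using finY D(1) by simp
      \<comment> \<open>Removing \<open>Q \<union> gQ\<close> ensures that \<open>hD\<close> avoids both holes \<open>Y\<close> and \<open>gY\<close>.\<close>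
      define H where "H = (+) u ` words S (12 * r) - (Q \<union> (+) g ` Q)"
      have "card ((+) u ` words S (12 * r)) - card (Q \<union> (+) g ` Q) \<le> card H"
        unfolding H_def using finQ by (intro diff_card_le_card_Diff) simp
      moreover have "card ((+) u ` words S (12 * r)) = card (words S (12 * r))"
        by (intro card_image) simp
      moreover have "card (Q \<union> (+) g ` Q) \<le> card Q + card Q"
        by (intro order.trans[OF card_Un_le] add_left_mono card_image_le finQ)
      ultimately have cardH: "card (words S r) \<le> 2 * card H"
        using big unfolding Q_def by linarith
      have "\<exists>d\<in>D. h + d \<in> E g" if h: "h \<in> H" for h
      proof -
        obtain d x where d: "d \<in> D" "x \<in> X" "x (h + d) \<noteq> x (- g + (h + d))"
          using D(3)[of g h] \<open>g \<in> \<Gamma>\<close> by (auto simp: \<Gamma>_def)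
        obtain t where t: "t \<in> words S (12 * r)" "h = u + t"
          using h by (auto simp: H_def)
        have td: "t + d \<in> words S (12 * r + r)"
          using t(1) d(1) Dr by (intro words_add) auto
        have "words S (19 * r + (12 * r + r)) \<subseteq> W"
          unfolding W_def by (rule words_mono) simp
        then have "u + (t + d) \<in> W" "- v + (t + d) \<in> W"
          using words_add[OF uv(1) td] words_add[OF words_uminus[OF sym uv(2)] td] by auto
        moreover have "u + (t + d) = h + d" "- v + (t + d) = - g + (h + d)"
          by (simp_all add: t(2) uv(3) minus_add add.assoc del: add_uminus_conv_diff)
        moreover have "h + d \<notin> Y"
        proof
          assume "h + d \<in> Y"
          then have "h + d - d \<in> Q"
            using d(1) unfolding Q_def by blast
          then show False
            using h by (simp add: H_def)
        qed
        moreover have "- g + (h + d) \<notin> Y"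
        proof
          assume "- g + (h + d) \<in> Y"
          then have "- g + (h + d) - d \<in> Q"
            using d(1) unfolding Q_def by blast
          then have "g + (- g + (h + d) - d) \<in> (+) g ` Q"
            by (rule imageI)
          moreover have "g + (- g + (h + d) - d) = h"
            by (simp add: add.assoc add_diff_eq)
          ultimately show False
            using h by (simp add: H_def)
        qed
        ultimately have "h + d \<in> E g"
          using d by (auto simp: E_def F_def)
        then show ?thesis
          using d(1) by blast
      qed
      then obtain \<delta> where \<delta>: "\<And>h. h \<in> H \<Longrightarrow> \<delta> h \<in> D" "\<And>h. h \<in> H \<Longrightarrow> h + \<delta> h \<in> E g"
        by metis
      have finE: "finite (E g)"
        using finF by (simp add: E_def)
      \<comment> \<open>Each detecting position is reached from at most \<open>card D\<close>
        elements of \<open>H\<close>.\<close>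
      have "H \<subseteq> (\<lambda>(e, d). e - d) ` (E g \<times> D)"
      proof
        fix h assume "h \<in> H"
        then show "h \<in> (\<lambda>(e, d). e - d) ` (E g \<times> D)"
          using \<delta> by (intro image_eqI[of _ _ "(h + \<delta> h, \<delta> h)"]) auto
      qed
      then have "card H \<le> card (E g \<times> D)"
        using finE D(1) by (intro surj_card_le) auto
      then have "card (words S r) \<le> 2 * card D * card (E g)"
        using cardH by (simp add: card_cartesian_product mult.commute mult.left_commute)
      moreover have "n * c \<le> card (words S r)"
        by (simp add: n_def)
      ultimately have "n * c \<le> 2 * card D * card (E g)"
        by linarith
      moreover have "n * c = 2 * card D * (n * q)"
        by (simp add: c_def)
      ultimately have "2 * card D * (n * q) \<le> 2 * card D * card (E g)"
        by simp
      then show ?thesis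
        using D(1,2) by (simp add: card_gt_0_iff)
    qed
    have bound: "real (card (periodic_patterns F X g (E g))) \<le> \<theta> ^ n * real (card (language F X))"
      if "g \<in> \<Gamma>" for g
    proof -
      have "card (periodic_patterns F X g (E g)) * (C + 1) ^ n \<le> C ^ n * card (language F X)"
        unfolding C_def using cardE[OF that] unfolding q_def
        by (intro card_periodic_patterns_decay[OF A(1) XA A(3) K(2,1) finF]) (auto simp: E_def)
      then have "real (card (periodic_patterns F X g (E g)) * (C + 1) ^ n) \<le> real (C ^ n * card (language F X))"
        by (simp only: of_nat_le_iff)
      then show ?thesis
        using \<open>C > 0\<close> by (simp add: \<theta>_def power_divide field_simps)
    qed
    \<comment> \<open>Union bound: a pattern outside \<open>?U\<close> is overlapping for no
      \<open>g\<close> in \<open>\<Gamma>\<close>.\<close>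
    let ?U = "\<Union>g\<in>\<Gamma>. periodic_patterns F X g (E g)"
    have "real (card ?U) \<le> real (\<Sum>g\<in>\<Gamma>. card (periodic_patterns F X g (E g)))"
      using card_UN_le[OF fin\<Gamma>] by (simp only: of_nat_le_iff)
    also have "\<dots> \<le> (\<Sum>g\<in>\<Gamma>. \<theta> ^ n * real (card (language F X)))"
      unfolding of_nat_sum by (rule sum_mono) (rule bound)
    also have "\<dots> = real (card \<Gamma>) * \<theta> ^ n * real (card (language F X))"
      by simp
    also have "\<dots> \<le> (real c * (real n + 1)) ^ 38 * \<theta> ^ n * real (card (language F X))"
      using card\<Gamma> \<theta> by (intro mult_right_mono) auto
    also have "\<dots> < 1 * real (card (language F X))"
      using M[OF nM] Lpos by (intro mult_strict_right_mono) auto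
    finally have "card ?U < card (language F X)"
      by simp
    moreover have "finite ?U"
      using finL by (rule rev_finite_subset) (auto simp: periodic_patterns_def)
    ultimately have "\<not> language F X \<subseteq> ?U"
      using card_mono leD by blast
    then obtain p where p: "p \<in> language F X" "p \<notin> ?U"
      by blast
    have "\<not> overlapping g F p" if g: "g \<in> \<Gamma>" for g
    proof
      assume ov: "overlapping g F p"
      have "p h = p (- g + h)" if "h \<in> E g" for h
      proof -
        have "h = g + (- g + h)"
          by simp
        then have "h \<in> F \<inter> (+) g ` F"
          using that unfolding E_def by blast
        then show ?thesis
          using ov by (simp add: overlapping_def translate_def)
      qed
      then show False
        using p g by (auto simp: periodic_patterns_def)
    qed
    then have "marker Y W X p"
      using p(1) finW finY YW by (auto simp: marker_def F_def \<Gamma>_def W_def)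
    then show "\<exists>p. marker Y (words S (37 * r)) X p"
      unfolding W_def by blast
  qed
qed

theorem theorem5:
  fixes A :: "'a set"
  assumes "infinite (UNIV :: 'g::group_add set)" and "finite A"
  shows "(\<forall>X :: ('g \<Rightarrow> 'a) set.
            subshift A X \<and> X \<noteq> {} \<and> strongly_irreducible X \<longrightarrow> markable X) \<and>
         (\<forall>S :: 'g set. finite_symmetric_generating_set S \<longrightarrow>
            (\<forall>X :: ('g \<Rightarrow> 'a) set.
               subshift A X \<and> X \<noteq> {} \<and> strongly_irreducible X \<longrightarrow>
               (\<exists>r\<^sub>0. \<forall>r\<ge>r\<^sub>0. \<exists>p. marker (word_ball S r) (word_ball S (37 * r)) X p)))"
proof -
  \<comment> \<open>For a general group, \<open>r = 1\<close> and the word set is any large enough finite symmetric set; for a word metric, it is the given generating set.\<close>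
  have "markable X \<and> (\<forall>S. finite_symmetric_generating_set S \<longrightarrow>
      (\<exists>r\<^sub>0. \<forall>r\<ge>r\<^sub>0. \<exists>p. marker (word_ball S r) (word_ball S (37 * r)) X p))"
    if X: "subshift A X" "X \<noteq> {}" "strongly_irreducible X" for X :: "('g \<Rightarrow> 'a) set"
  proof (rule marker_exists[OF assms(2) X], intro conjI allI impI)
    fix D :: "'g set" and M
    assume D: "finite D" and marker:
      "\<And>S r Y. \<lbrakk>finite S; \<And>s. s \<in> S \<Longrightarrow> - s \<in> S; D \<subseteq> words S r; Y \<subseteq> words S r;
          Y \<subset> words S (37 * r); M \<le> card (words S r);
          card (words S r) + 4 * card {y - d |y d. y \<in> Y \<and> d \<in> D} \<le> 2 * card (words S (12 * r))\<rbrakk>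
        \<Longrightarrow> \<exists>p. marker Y (words S (37 * r)) X p"
    show "markable X"
      unfolding markable_def
    proof (intro allI impI)
      fix Y :: "'g set"
      assume Y: "finite Y"
      \<comment> \<open>The summands give, in order, the threshold \<open>M\<close>, the room for
        the holes, and a word set larger than \<open>Y\<close>; padding by \<open>T\<close> reaches
        this size because the group is infinite.\<close>
      define m where "m = M + 4 * card {y - d |y d. y \<in> Y \<and> d \<in> D} + card Y + 1"
      obtain T :: "'g set" where T: "finite T" "card T = m"
        using infinite_arbitrarily_large[OF assms(1)] by blast
      define S where "S = Y \<union> D \<union> T \<union> uminus ` (Y \<union> D \<union> T)"
      have S: "finite S" "\<And>s. s \<in> S \<Longrightarrow> - s \<in> S"
        using Y D T by (auto simp: S_def)
      have sub: "S \<subseteq> words S 1" "S \<subseteq> words S (37 * 1)"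
        by (intro subset_words; simp)+
      have "T \<subseteq> words S 1"
        using sub by (auto simp: S_def)
      then have m: "m \<le> card (words S 1)"
        using T finite_words[OF S(1)] card_mono by blast
      have mono: "card (words S 1) \<le> card (words S (n * 1))" if "1 \<le> n" for n
        using that by (intro card_mono finite_words S(1) words_mono) simp
      have "Y \<noteq> words S (37 * 1)"
        using mono[of 37] m by (auto simp: m_def)
      then have "\<exists>p. marker Y (words S (37 * 1)) X p"
        using sub m mono[of 12] by (intro marker S) (auto simp: S_def m_def)
      then show "\<exists>W p. finite W \<and> marker Y W X p"
        by (auto simp: marker_def)
    qed
    fix S :: "'g set"
    assume gen: "finite_symmetric_generating_set S"
    have S: "finite S" "\<And>s. s \<in> S \<Longrightarrow> - s \<in> S" "\<exists>n. g \<in> words S n" for g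
      using gen unfolding finite_symmetric_generating_set_def words_def mem_Collect_eq
      by (metis order_refl)+
    have "\<exists>n. D \<subseteq> words S n"
      using D
    proof (induction rule: finite_induct)
      case (insert d D)
      then obtain m n where "D \<subseteq> words S m" "d \<in> words S n"
        using S(3) by blast
      then have "insert d D \<subseteq> words S (max m n)"
        using words_mono[of m "max m n" S] words_mono[of n "max m n" S] by auto
      then show ?case by blast
    qed simp
    then obtain n where n: "D \<subseteq> words S n"
      by blast
    show "\<exists>r\<^sub>0. \<forall>r\<ge>r\<^sub>0. \<exists>p. marker (word_ball S r) (word_ball S (37 * r)) X p"
      unfolding word_ball_eq_words[OF gen]
    proof (intro exI[of _ "M + n + 1"] allI impI marker S)
      \<comment> \<open>\<open>n\<close> puts \<open>D\<close> into the ball, \<open>M\<close> makes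
        the ball large, and \<open>1\<close> ensures \<open>r + 1 \<le> 37 * r\<close> and the room
        for three balls.\<close>
      fix r assume r: "M + n + 1 \<le> r"
      show Dr: "D \<subseteq> words S r"
        using n words_mono[of n r S] r by auto
      show "M \<le> card (words S r)"
        using less_card_words[OF assms(1) S(1,3), of r] r by simp
      show "words S r \<subset> words S (37 * r)"
        using words_strict[OF assms(1) S(1,3), of r] words_mono[of "Suc r" "37 * r" S] r by auto
      have "{y - d |y d. y \<in> words S r \<and> d \<in> D} \<subseteq> words S (2 * r)"
      proof clarify
        fix y d assume "y \<in> words S r" "d \<in> D"
        then have "y + - d \<in> words S (r + r)"
          using Dr words_uminus[OF S(2)] by (intro words_add) auto
        then show "y - d \<in> words S (2 * r)"
          by (simp add: mult_2)
      qed
      then have "card {y - d |y d. y \<in> words S r \<and> d \<in> D} \<le> card (words S (2 * r))"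
        by (intro card_mono finite_words S(1))
      moreover have "card (words S r) \<le> card (words S (2 * r))"
        by (intro card_mono finite_words S(1) words_mono) simp
      moreover have "3 * card (words S (2 * r)) \<le> card (words S (12 * r))"
        using r by (intro three_balls[OF assms(1) S(1,3,2)]) auto
      ultimately show "card (words S r) + 4 * card {y - d |y d. y \<in> words S r \<and> d \<in> D}
          \<le> 2 * card (words S (12 * r))"
        by linarith
    qed simp_all
  qed
  then show ?thesis
    by blast
qed

end
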